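(* $\mathrm{Rs}(2K_2)=\mathrm{Rs}(2K_2,P_4)=\mathrm{Rs}(P_4)=13$.
   Context: All graphs are finite and simple. $2K_2$ is the matching with two edges, $P_4$ the path on 4 vertices. A (not necessarily induced) subgraph $H$ of a host graph $F$ is singular if the degrees $d_F(v)$, $v\in V(H)$, taken in $F$, are all equal or pairwise distinct. In an edge 2-coloring of $K_m$, the host graph of a color is the spanning graph on all $m$ vertices formed by the edges of that color. $\mathrm{Rs}(G_1,G_2)$ is the smallest integer $N$ such that for every $m\ge N$ and every 2-coloring of the edges of $K_m$, the graph of color 1 contains a singular subgraph isomorphic to $G_1$ or the graph of color 2 contains a singular subgraph isomorphic to $G_2$; and $\mathrm{Rs}(G)=\mathrm{Rs}(G,G)$. *)

theory Defs
  imports Main "HOL-Library.Extended_Nat" "HOL-Library.FuncSet"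
begin

type_synonym 'a graph = "'a set \<times> 'a set set"

abbreviation verts :: "'a graph \<Rightarrow> 'a set" where
  "verts G \<equiv> fst G"

abbreviation edges :: "'a graph \<Rightarrow> 'a set set" where
  "edges G \<equiv> snd G"

definition simple_graph :: "'a graph \<Rightarrow> bool" where
  "simple_graph G \<longleftrightarrow>
     finite (verts G) \<and> (\<forall>e \<in> edges G. e \<subseteq> verts G \<and> card e = 2)"

definition degree :: "'a graph \<Rightarrow> 'a \<Rightarrow> nat" where
  "degree G v = card {e \<in> edges G. v \<in> e}"

definition subgraph :: "'a graph \<Rightarrow> 'a graph \<Rightarrow> bool" where
  "subgraph H F \<longleftrightarrow>
     simple_graph H \<and> verts H \<subseteq> verts F \<and> edges H \<subseteq> edges F"

definition isomorphic :: "'a graph \<Rightarrow> 'b graph \<Rightarrow> bool" where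
  "isomorphic G H \<longleftrightarrow>
     (\<exists>f. bij_betw f (verts G) (verts H) \<and>
       (\<forall>u \<in> verts G. \<forall>v \<in> verts G. {u, v} \<in> edges G \<longleftrightarrow> {f u, f v} \<in> edges H))"

text \<open>The degrees are those in the host graph \<open>F\<close>, not in \<open>H\<close>.\<close>

definition singular :: "'a graph \<Rightarrow> 'a graph \<Rightarrow> bool" where
  "singular F H \<longleftrightarrow>
     (\<forall>u \<in> verts H. \<forall>v \<in> verts H. degree F u = degree F v) \<or>
     inj_on (degree F) (verts H)"

definition has_singular_copy :: "'a graph \<Rightarrow> 'b graph \<Rightarrow> bool" where
  "has_singular_copy F G \<longleftrightarrow>
     (\<exists>H. subgraph H F \<and> isomorphic G H \<and> singular F H)"

definition complete_graph :: "nat \<Rightarrow> nat graph" where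
  "complete_graph m = ({..<m}, {e. e \<subseteq> {..<m} \<and> card e = 2})"

definition color_graph :: "nat \<Rightarrow> (nat set \<Rightarrow> nat) \<Rightarrow> nat \<Rightarrow> nat graph" where
  "color_graph m c i =
     (verts (complete_graph m), {e \<in> edges (complete_graph m). c e = i})"

definition singular_ramsey_bound :: "'a graph \<Rightarrow> 'b graph \<Rightarrow> nat \<Rightarrow> bool" where
  "singular_ramsey_bound G1 G2 N \<longleftrightarrow>
     (\<forall>m \<ge> N. \<forall>c \<in> edges (complete_graph m) \<rightarrow> {1, 2}.
        has_singular_copy (color_graph m c 1) G1 \<or>
        has_singular_copy (color_graph m c 2) G2)"

text \<open>The value is \<open>\<infinity>\<close> if no bound exists, so an equation \<open>Rs2 G1 G2 = 13\<close>
  includes the existence of a bound.\<close>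

definition Rs2 :: "'a graph \<Rightarrow> 'b graph \<Rightarrow> enat" where
  "Rs2 G1 G2 = Inf (enat ` {N. singular_ramsey_bound G1 G2 N})"

definition Rs :: "'a graph \<Rightarrow> enat" where
  "Rs G = Rs2 G G"

definition two_K2 :: "nat graph" where
  "two_K2 = ({0, 1, 2, 3}, {{0, 1}, {2, 3}})"

definition P4 :: "nat graph" where
  "P4 = ({0, 1, 2, 3}, {{0, 1}, {1, 2}, {2, 3}})"

end

theory Submission
  imports Defs
begin

text \<open>
  Since \<open>2K\<^sub>2\<close> is a spanning subgraph of \<open>P\<^sub>4\<close>, and singularity only concerns the
  vertex set of a copy, every singular \<open>P\<^sub>4\<close> contains a singular \<open>2K\<^sub>2\<close>. Hence
  \<open>Rs(2K\<^sub>2) \<le> Rs(2K\<^sub>2, P\<^sub>4) \<le> Rs(P\<^sub>4)\<close>, and it is enough to bound the first number from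
  below and the last one from above. The two color degrees of a vertex of \<open>K\<^sub>m\<close> add up to
  \<open>m - 1\<close>, so both colors have the same degree classes and the same singular vertex sets.

  \<^bold>\<open>Lower bound\<close> (\<open>no_singular_two_K2_coloring12\<close>). In a 2-colored \<open>K\<^sub>4\<close> without a
  monochromatic perfect matching each of the three perfect matchings has one edge of each
  color, so one color is a triangle and the other a star. There is a coloring of
  \<open>K\<^sub>1\<^sub>2\<close> with exactly three degree classes, each of size 4 and each colored in this way.
  Four vertices with pairwise distinct degrees do not exist in it, and four vertices with
  equal degrees form a whole class.

  \<^bold>\<open>Upper bound\<close> (\<open>alternating_matchings.card_le_12\<close>). A 2-colored \<open>K\<^sub>4\<close> with a
  monochromatic perfect matching also has a monochromatic \<open>P\<^sub>4\<close>, so it suffices to find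
  the matching on a singular 4-set. Suppose that there is none. The
  Petersen graph, whose vertices are the edges of \<open>K\<^sub>5\<close> and which joins disjoint edges,
  is not bipartite, so neither five vertices of equal degree nor five of distinct degrees
  exist: there are at most four degree classes, each of size at most 4. With at most three classes there are at most 12
  vertices. With four classes, an edge between two classes has the opposite
  color of every edge between the other two, so all edges between two given classes have
  the same color. All vertices of a class thus have the same color degree to the outside,
  hence also inside the class. But a class of size 4 would carry a triangle and a star, which
  are not regular. So each of the four classes has at most three vertices, and again there are at
  most 12 vertices.
\<close>

section \<open>Singular copies and spanning subgraphs\<close>

lemma has_singular_copy_spanning_subgraph:
  assumes "simple_graph G'" "verts G' = verts G" "edges G' \<subseteq> edges G"
    and copy: "has_singular_copy F G"
  shows "has_singular_copy F G'"
proof -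
  obtain H f where H: "subgraph H F" "singular F H"
    and f: "bij_betw f (verts G) (verts H)"
    and adj: "\<forall>u \<in> verts G. \<forall>v \<in> verts G. {u, v} \<in> edges G \<longleftrightarrow> {f u, f v} \<in> edges H"
    using copy unfolding has_singular_copy_def isomorphic_def by blast
  have inj: "inj_on f (verts G)"
    using f by (simp add: bij_betw_def)
  have sub: "e \<subseteq> verts G" if "e \<in> edges G'" for e
    using that assms(1,2) by (auto simp: simple_graph_def)
  let ?H = "(verts H, (`) f ` edges G')"
  have "(`) f ` edges G' \<subseteq> edges H"
  proof
    fix e assume "e \<in> (`) f ` edges G'"
    then obtain e' where e': "e' \<in> edges G'" "e = f ` e'" by blast
    then obtain u v where "e' = {u, v}"
      using assms(1) by (metis card_2_iff simple_graph_def)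
    then show "e \<in> edges H"
      using e' sub[OF e'(1)] adj assms(3) by auto
  qed
  then have "subgraph ?H F"
    using H(1) unfolding subgraph_def simple_graph_def fst_conv snd_conv by (meson subset_iff)
  moreover have "{u, v} \<in> edges G' \<longleftrightarrow> {f u, f v} \<in> (`) f ` edges G'"
    if "u \<in> verts G'" "v \<in> verts G'" for u v
  proof
    assume "{f u, f v} \<in> (`) f ` edges G'"
    then obtain e where e: "e \<in> edges G'" "f ` {u, v} = f ` e" by auto
    then have "{u, v} = e"
      using inj_on_image_eq_iff[OF inj, of "{u, v}" e] that sub assms(2) by auto
    then show "{u, v} \<in> edges G'" using e by simp
  qed (metis image_empty image_insert imageI)
  then have "isomorphic G' ?H"
    using f assms(2) unfolding isomorphic_def by auto
  moreover have "singular F ?H"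
    using H(2) by (simp add: singular_def)
  ultimately show ?thesis
    unfolding has_singular_copy_def by blast
qed

lemma Rs2_mono:
  assumes "\<And>F :: nat graph. has_singular_copy F G1 \<Longrightarrow> has_singular_copy F G1'"
    and "\<And>F :: nat graph. has_singular_copy F G2 \<Longrightarrow> has_singular_copy F G2'"
  shows "Rs2 G1' G2' \<le> Rs2 G1 G2"
  unfolding Rs2_def singular_ramsey_bound_def
  by (intro Inf_superset_mono image_mono) (use assms in blast)

lemma has_singular_copy_P4_imp_two_K2:
  "has_singular_copy F P4 \<Longrightarrow> has_singular_copy F two_K2"
  by (rule has_singular_copy_spanning_subgraph[where G = P4])
    (auto simp: simple_graph_def two_K2_def P4_def)

text \<open>Singularity as a property of the vertex set alone: it then does not depend on which
  subgraph spans the set, and can be transferred between degree functions that have the same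
  classes.\<close>

definition equal_or_distinct_on :: "('a \<Rightarrow> 'b) \<Rightarrow> 'a set \<Rightarrow> bool" where
  "equal_or_distinct_on f S \<longleftrightarrow> (\<forall>u \<in> S. \<forall>v \<in> S. f u = f v) \<or> inj_on f S"

lemma equal_or_distinct_on_subset:
  "equal_or_distinct_on f S \<Longrightarrow> T \<subseteq> S \<Longrightarrow> equal_or_distinct_on f T"
  unfolding equal_or_distinct_on_def by (meson inj_on_subset subsetD)

lemma equal_or_distinct_on_cong:
  assumes "\<And>u v. u \<in> S \<Longrightarrow> v \<in> S \<Longrightarrow> f u = f v \<longleftrightarrow> g u = g v"
  shows "equal_or_distinct_on f S \<longleftrightarrow> equal_or_distinct_on g S"
  using assms by (simp add: equal_or_distinct_on_def inj_on_def)

lemma singular_iff: "singular F H \<longleftrightarrow> equal_or_distinct_on (degree F) (verts H)"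
  by (simp add: singular_def equal_or_distinct_on_def)

lemma has_singular_copy_two_K2D:
  assumes "has_singular_copy F two_K2"
  obtains a b c d where "distinct [a, b, c, d]" "{a, b} \<in> edges F" "{c, d} \<in> edges F"
    "{a, b, c, d} \<subseteq> verts F" "equal_or_distinct_on (degree F) {a, b, c, d}"
proof -
  obtain H f where H: "subgraph H F" "singular F H"
    and f: "bij_betw f {0, 1, 2, 3 :: nat} (verts H)"
    and adj: "\<forall>u \<in> {0, 1, 2, 3}. \<forall>v \<in> {0, 1, 2, 3}.
      {u, v} \<in> {{0, 1}, {2, 3}} \<longleftrightarrow> {f u, f v} \<in> edges H"
    using assms unfolding has_singular_copy_def isomorphic_def two_K2_def fst_conv snd_conv by blast
  have V: "verts H = {f 0, f 1, f 2, f 3}"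
    using f by (auto simp: bij_betw_def)
  have "distinct [f 0, f 1, f 2, f 3]"
    using f by (auto simp: bij_betw_def inj_on_def)
  moreover have "{f 0, f 1} \<in> edges H" "{f 2, f 3} \<in> edges H"
    using adj by auto
  ultimately show ?thesis
    using that[of "f 0" "f 1" "f 2" "f 3"] H V by (auto simp: subgraph_def singular_iff)
qed

lemma has_singular_copy_P4I:
  assumes "distinct [a, b, c, d]" "{a, b, c, d} \<subseteq> verts F"
    and "{a, b} \<in> edges F" "{b, c} \<in> edges F" "{c, d} \<in> edges F"
    and "equal_or_distinct_on (degree F) {a, b, c, d}"
  shows "has_singular_copy F P4"
proof -
  let ?H = "({a, b, c, d}, {{a, b}, {b, c}, {c, d}})"
  let ?f = "\<lambda>i :: nat. [a, b, c, d] ! i"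
  have "subgraph ?H F"
    using assms by (auto simp: subgraph_def simple_graph_def)
  moreover have "bij_betw ?f {0, 1, 2, 3} {a, b, c, d}"
    using assms(1) by (auto simp: bij_betw_def inj_on_def)
  then have "isomorphic P4 ?H"
    unfolding isomorphic_def P4_def using assms(1)
    by (intro exI[of _ ?f]) (auto simp: doubleton_eq_iff)
  moreover have "singular F ?H"
    using assms(6) by (simp add: singular_iff)
  ultimately show ?thesis
    unfolding has_singular_copy_def by blast
qed

section \<open>Degrees in the color graphs\<close>

lemma verts_color_graph [simp]: "verts (color_graph m c i) = {..<m}"
  by (simp add: color_graph_def complete_graph_def)

lemma edge_color_graph_iff:
  "{u, v} \<in> edges (color_graph m c i) \<longleftrightarrow> u < m \<and> v < m \<and> u \<noteq> v \<and> c {u, v} = i"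
  by (auto simp: color_graph_def complete_graph_def card_insert_if)

lemma degree_color_graph:
  assumes "v < m"
  shows "degree (color_graph m c i) v = card {u \<in> {..<m}. u \<noteq> v \<and> c {v, u} = i}"
proof -
  have "{e \<in> edges (color_graph m c i). v \<in> e} =
      (\<lambda>u. {v, u}) ` {u \<in> {..<m}. u \<noteq> v \<and> c {v, u} = i}"
  proof (intro equalityI subsetI)
    fix e assume e: "e \<in> {e \<in> edges (color_graph m c i). v \<in> e}"
    then have "card e = 2" "v \<in> e"
      by (auto simp: color_graph_def complete_graph_def)
    then obtain u where "e = {v, u}"
      by (metis card_2_iff insert_commute insertE singletonD)
    then show "e \<in> (\<lambda>u. {v, u}) ` {u \<in> {..<m}. u \<noteq> v \<and> c {v, u} = i}"
      using e by (auto simp: edge_color_graph_iff)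
  qed (use assms in \<open>auto simp: edge_color_graph_iff\<close>)
  moreover have "inj_on (\<lambda>u. {v, u}) A" for A
    by (auto simp: inj_on_def doubleton_eq_iff)
  ultimately show ?thesis
    by (simp add: degree_def card_image)
qed

lemma coloring_cases:
  assumes "c \<in> edges (complete_graph m) \<rightarrow> {1, 2}" "u < m" "v < m" "u \<noteq> v"
  shows "c {u, v} = 1 \<or> c {u, v} = 2"
proof -
  have "{u, v} \<in> edges (complete_graph m)"
    using assms by (simp add: complete_graph_def)
  then show ?thesis
    using assms(1) by fastforce
qed

lemma degree_color_graph_add:
  assumes c: "c \<in> edges (complete_graph m) \<rightarrow> {1, 2}" and v: "v < m"
  shows "degree (color_graph m c 1) v + degree (color_graph m c 2) v = m - 1"
proof -
  let ?N = "\<lambda>i. {u \<in> {..<m}. u \<noteq> v \<and> c {v, u} = i}"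
  have "?N 1 \<union> ?N 2 = {..<m} - {v}"
    using coloring_cases[OF c v] by force
  moreover have "?N 1 \<inter> ?N 2 = {}" by auto
  ultimately show ?thesis
    using card_Un_disjoint[of "?N 1" "?N 2"] v by (simp add: degree_color_graph)
qed

text \<open>As the two color degrees of a vertex have a constant sum, each one determines the other.
  So it is enough to consider the degrees in color 1.\<close>

lemma equal_or_distinct_on_degree_color_graph:
  assumes c: "c \<in> edges (complete_graph m) \<rightarrow> {1, 2}" and S: "S \<subseteq> {..<m}"
    and i: "i \<in> {1, 2}"
  shows "equal_or_distinct_on (degree (color_graph m c i)) S \<longleftrightarrow>
    equal_or_distinct_on (degree (color_graph m c 1)) S"
proof -
  have "degree (color_graph m c 2) u = degree (color_graph m c 2) v \<longleftrightarrow>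
      degree (color_graph m c 1) u = degree (color_graph m c 1) v" if "u \<in> S" "v \<in> S" for u v
  proof -
    have "u < m" "v < m" using that S by auto
    from this[THEN degree_color_graph_add[OF c]] show ?thesis by linarith
  qed
  then show ?thesis
    using i equal_or_distinct_on_cong[of S] by blast
qed

section \<open>A coloring of the complete graph on 12 vertices\<close>

text \<open>The degree classes are the blocks \<open>{0..3}\<close>, \<open>{4..7}\<close>, \<open>{8..11}\<close>. The first
  row gives the red edges inside them: a triangle in the first and in the last block, a star
  with center 4 in the middle one. Vertices of a block then differ by 2 in their inner
  red degree: 0 is two short of the rest of its block, 8 likewise, and 4 is two ahead. The second
  row compensates this and makes all blocks regular, with degrees 2, 3, 3. The last row is a
  2-regular graph between the first and the last block; it raises their degrees by 2 and so
  separates all three blocks.\<close>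

definition red_edges :: "(nat \<times> nat) list" where
  "red_edges =
    [(1,2), (1,3), (2,3), (4,5), (4,6), (4,7), (9,10), (9,11), (10,11),
     (0,7), (0,11), (5,8), (6,8), (7,8), (5,9), (6,10),
     (0,8), (0,9), (1,9), (1,10), (2,10), (2,11), (3,11), (3,8)]"

definition coloring12 :: "nat set \<Rightarrow> nat" where
  "coloring12 e = (if \<exists>(u, v) \<in> set red_edges. e = {u, v} then 1 else 2)"

abbreviation red12 :: "nat \<Rightarrow> nat \<Rightarrow> bool" where
  "red12 u v \<equiv> (u, v) \<in> set red_edges \<or> (v, u) \<in> set red_edges"

lemma coloring12_eq_1_iff: "coloring12 {u, v} = 1 \<longleftrightarrow> red12 u v"
  by (auto simp: coloring12_def doubleton_eq_iff)

lemma coloring12_range: "coloring12 \<in> A \<rightarrow> {1, 2}"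
  by (auto simp: coloring12_def)

lemma degree_coloring12:
  assumes "v < 12"
  shows "degree (color_graph 12 coloring12 1) v = [4, 3, 5] ! (v div 4)"
proof -
  have "\<forall>v \<in> set [0..<12].
      length (filter (\<lambda>u. u \<noteq> v \<and> red12 v u) [0..<12]) = [4, 3, 5] ! (v div 4)"
    unfolding red_edges_def by code_simp
  moreover have "card {u \<in> {..<12}. u \<noteq> v \<and> red12 v u} =
      length (filter (\<lambda>u. u \<noteq> v \<and> red12 v u) [0..<12])"
    by (subst distinct_card[symmetric]) (auto simp: atLeast0LessThan intro: arg_cong[where f = card])
  ultimately show ?thesis
    using assms by (simp add: degree_color_graph coloring12_eq_1_iff[symmetric])
qed

text \<open>Three classes are too few for four distinct degrees, and classes of size 4 leave only
  one choice for four equal ones.\<close>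

lemma equal_or_distinct_on_imp_block:
  fixes S :: "nat set"
  assumes S: "S \<subseteq> {..<12}" "card S = 4"
    and eq: "equal_or_distinct_on (\<lambda>v. [4, 3, 5 :: nat] ! (v div 4)) S"
  shows "\<exists>q < 3. S = {4 * q, 4 * q + 1, 4 * q + 2, 4 * q + 3}"
proof -
  let ?D = "\<lambda>v :: nat. [4, 3, 5 :: nat] ! (v div 4)"
  have q: "v div 4 \<in> {0, 1, 2}" if "v \<in> S" for v
    using that S(1) by auto
  have "\<not> inj_on ?D S"
  proof
    assume "inj_on ?D S"
    then have "card (?D ` S) = 4" using S(2) by (simp add: card_image)
    moreover have "?D ` S \<subseteq> {4, 3, 5}" using q by fastforce
    then have "card (?D ` S) \<le> card {4, 3, 5 :: nat}" by (intro card_mono) auto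
    ultimately show False by simp
  qed
  moreover obtain v where v: "v \<in> S" using S(2) by fastforce
  ultimately have D: "?D u = ?D v" if "u \<in> S" for u
    using eq that unfolding equal_or_distinct_on_def by blast
  have "u div 4 = v div 4" if "u \<in> S" for u
    using D[OF that] q[OF that] q[OF v] by auto
  then have "S \<subseteq> {4 * (v div 4), 4 * (v div 4) + 1, 4 * (v div 4) + 2, 4 * (v div 4) + 3}"
  proof (intro subsetI)
    fix u assume *: "\<And>u. u \<in> S \<Longrightarrow> u div 4 = v div 4" "u \<in> S"
    have "u = 4 * (u div 4) + u mod 4" "u mod 4 < 4" by simp_all
    then show "u \<in> {4 * (v div 4), 4 * (v div 4) + 1, 4 * (v div 4) + 2, 4 * (v div 4) + 3}"
      unfolding *(1)[OF *(2)] by auto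
  qed
  then have "S = {4 * (v div 4), 4 * (v div 4) + 1, 4 * (v div 4) + 2, 4 * (v div 4) + 3}"
    using S(2) by (intro card_subset_eq) auto
  then show ?thesis using q[OF v] by (intro exI[of _ "v div 4"]) auto
qed

lemma red12_block_matching:
  assumes "q < 3" "{a, b, c, d} = {4 * q, 4 * q + 1, 4 * q + 2, 4 * q + 3}"
    and "distinct [a, b, c, d]"
  shows "red12 a b \<longleftrightarrow> \<not> red12 c d"
proof -
  let ?B = "\<lambda>q :: nat. [4 * q, 4 * q + 1, 4 * q + 2, 4 * q + 3]"
  have "\<forall>q \<in> set [0..<3]. \<forall>a \<in> set (?B q). \<forall>b \<in> set (?B q). \<forall>c \<in> set (?B q). \<forall>d \<in> set (?B q).
      distinct [a, b, c, d] \<longrightarrow> (red12 a b \<longleftrightarrow> \<not> red12 c d)"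
    unfolding red_edges_def by code_simp
  moreover have "q \<in> set [0..<3]" using assms(1) by simp
  moreover have "a \<in> set (?B q)" "b \<in> set (?B q)" "c \<in> set (?B q)" "d \<in> set (?B q)"
    using assms(2) by auto
  ultimately show ?thesis using assms(3) by blast
qed

lemma no_singular_two_K2_coloring12:
  assumes i: "i \<in> {1, 2}"
  shows "\<not> has_singular_copy (color_graph 12 coloring12 i) two_K2"
proof
  assume "has_singular_copy (color_graph 12 coloring12 i) two_K2"
  then obtain a b c d where dist: "distinct [a, b, c, d]"
    and ab: "coloring12 {a, b} = i" and cd: "coloring12 {c, d} = i"
    and sub: "{a, b, c, d} \<subseteq> {..<12}"
    and "equal_or_distinct_on (degree (color_graph 12 coloring12 i)) {a, b, c, d}"
    by (elim has_singular_copy_two_K2D) (auto simp: edge_color_graph_iff)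
  then have "equal_or_distinct_on (degree (color_graph 12 coloring12 1)) {a, b, c, d}"
    using equal_or_distinct_on_degree_color_graph[OF coloring12_range sub i] by simp
  moreover have "degree (color_graph 12 coloring12 1) v = [4, 3, 5] ! (v div 4)"
    if "v \<in> {a, b, c, d}" for v
    using that sub by (intro degree_coloring12) blast
  ultimately have "equal_or_distinct_on (\<lambda>v. [4, 3, 5 :: nat] ! (v div 4)) {a, b, c, d}"
    using equal_or_distinct_on_cong[of "{a, b, c, d}" "degree (color_graph 12 coloring12 1)"
      "\<lambda>v. [4, 3, 5 :: nat] ! (v div 4)"] by presburger
  then obtain q where "q < 3" "{a, b, c, d} = {4 * q, 4 * q + 1, 4 * q + 2, 4 * q + 3}"
    using equal_or_distinct_on_imp_block[OF sub] dist by auto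
  then have "red12 a b \<longleftrightarrow> \<not> red12 c d"
    using dist by (rule red12_block_matching)
  then show False
    using ab cd by (metis coloring12_eq_1_iff)
qed

lemma Rs_two_K2_ge: "13 \<le> Rs two_K2"
  unfolding Rs_def Rs2_def
proof (rule Inf_greatest)
  fix x assume "x \<in> enat ` {N. singular_ramsey_bound two_K2 two_K2 N}"
  then obtain N where N: "x = enat N" "singular_ramsey_bound two_K2 two_K2 N" by blast
  have "\<not> N \<le> 12"
    using N(2) coloring12_range no_singular_two_K2_coloring12
    unfolding singular_ramsey_bound_def by blast
  then show "13 \<le> x" by (simp add: N(1) numeral_eq_enat)
qed

section \<open>Monochromatic matchings on singular sets\<close>

text \<open>If one of the edges joining the two matching edges has their color, it
  completes them to a path; otherwise these edges form a 4-cycle in the other color.\<close>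

lemma mono_matching_imp_mono_path:
  fixes r :: "'a \<Rightarrow> 'a \<Rightarrow> bool"
  assumes sym: "\<And>x y. r x y \<longleftrightarrow> r y x"
    and "distinct [a, b, c, d]" "r a b \<longleftrightarrow> r c d"
  obtains w x y z where "distinct [w, x, y, z]" "{w, x, y, z} = {a, b, c, d}"
    "r w x \<longleftrightarrow> r x y" "r x y \<longleftrightarrow> r y z"
proof -
  consider "r b c \<longleftrightarrow> r a b" | "r a c \<longleftrightarrow> r a b" | "r b d \<longleftrightarrow> r a b"
    | "r b c \<noteq> r a b" "r a c \<noteq> r a b" "r b d \<noteq> r a b" by blast
  moreover have flip: "r b a \<longleftrightarrow> r a b" "r c b \<longleftrightarrow> r b c" "r d c \<longleftrightarrow> r c d"
    using sym by blast+
  ultimately show ?thesis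
  proof cases
    case 1
    show ?thesis
      by (rule that[of a b c d], use assms(2) in force, force, (use 1 flip assms(3) in argo)+)
  next
    case 2
    show ?thesis
      by (rule that[of b a c d], use assms(2) in force, force, (use 2 flip assms(3) in argo)+)
  next
    case 3
    show ?thesis
      by (rule that[of a b d c], use assms(2) in force, force, (use 3 flip assms(3) in argo)+)
  next
    case 4
    show ?thesis
      by (rule that[of a c b d], use assms(2) in force, force, (use 4 flip assms(3) in argo)+)
  qed
qed

text \<open>A hypothetical counterexample to the upper bound, with \<open>r\<close> as the graph of color 1:
  by \<open>alternating\<close>, every perfect matching of a singular 4-set has one edge of each color.\<close>

locale alternating_matchings =
  fixes V :: "'a set" and r :: "'a \<Rightarrow> 'a \<Rightarrow> bool" and D :: "'a \<Rightarrow> nat"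
  assumes fin: "finite V"
    and sym: "r x y \<longleftrightarrow> r y x"
    and D: "v \<in> V \<Longrightarrow> D v = card {u \<in> V. u \<noteq> v \<and> r v u}"
    and alternating: "\<lbrakk>distinct [a, b, c, d]; {a, b, c, d} \<subseteq> V; equal_or_distinct_on D {a, b, c, d}\<rbrakk>
      \<Longrightarrow> r a b \<noteq> r c d"
begin

text \<open>Among five vertices with this property the edges, taken as vertices of the Petersen
  graph, would be properly 2-colored; but that graph contains a 5-cycle.\<close>

lemma card_equal_or_distinct_le_4:
  assumes S: "S \<subseteq> V" "equal_or_distinct_on D S"
  shows "card S \<le> 4"
proof (rule ccontr)
  assume "\<not> card S \<le> 4"
  then obtain T where "T \<subseteq> S" "card T = 5" "finite T"
    using obtain_subset_with_card_n[of 5 S] by force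
  then obtain xs where xs: "set xs = T" "length xs = 5" "distinct xs"
    by (metis finite_distinct_list distinct_card)
  then obtain a b c d e where xs_eq: "xs = [a, b, c, d, e]"
    by (auto simp: eval_nat_numeral length_Suc_conv)
  have alt: "r w x \<noteq> r y z" if "distinct [w, x, y, z]" "{w, x, y, z} \<subseteq> T" for w x y z
    using alternating[OF that(1)] equal_or_distinct_on_subset[OF S(2)] S(1) that(2) \<open>T \<subseteq> S\<close>
    by (meson subset_trans)
  \<comment> \<open>Consecutive edges in the cyclic sequence \<open>ab, cd, ea, bc, de\<close> are disjoint.\<close>
  have "r a b \<noteq> r c d" "r c d \<noteq> r e a" "r e a \<noteq> r b c" "r b c \<noteq> r d e" "r d e \<noteq> r a b"
    by (rule alt; use xs xs_eq in auto)+
  then show False by blast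
qed

text \<open>Choosing \<open>y\<close> and \<open>z\<close> in the two classes that contain neither \<open>u\<close> nor \<open>x\<close> gives a set
  of four vertices with distinct degrees, in which \<open>ux\<close> has the color opposite to \<open>yz\<close>. The
  same \<open>y\<close> and \<open>z\<close> serve for \<open>v\<close>.\<close>

lemma color_between_classes:
  assumes four: "card (D ` V) = 4"
    and "u \<in> V" "v \<in> V" "x \<in> V" "D u = D v" "D x \<noteq> D u"
  shows "r u x \<longleftrightarrow> r v x"
proof -
  have "card (D ` V - {D u, D x}) = 2"
    using assms by (subst card_Diff_subset) auto
  then obtain i j where ij: "D ` V - {D u, D x} = {i, j}" "i \<noteq> j"
    by (meson card_2_iff)
  then obtain y z where "y \<in> V" "D y = i" "z \<in> V" "D z = j"
    by (metis Diff_iff imageE insertI1 insertI2)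
  moreover have "i \<notin> {D u, D x}" "j \<notin> {D u, D x}" using ij by auto
  ultimately have "r w x \<noteq> r y z" if "w \<in> {u, v}" for w
    using that assms ij(2)
    by (intro alternating) (auto simp: equal_or_distinct_on_def inj_on_def)
  then show ?thesis by blast
qed

text \<open>By the previous lemma the vertices of a class have the same number of red neighbors
  outside it, and therefore also inside. On a class of size 4 the three perfect matchings
  contribute one red edge each, and a regular graph on 4 vertices with 3 edges would
  have degree \<open>6/4\<close>.\<close>

lemma card_degree_class_le_3:
  assumes four: "card (D ` V) = 4"
  shows "card {v \<in> V. D v = k} \<le> 3"
proof (rule ccontr)
  let ?K = "{v \<in> V. D v = k}"
  assume "\<not> card ?K \<le> 3"
  moreover have "card ?K \<le> 4"
    by (rule card_equal_or_distinct_le_4) (auto simp: equal_or_distinct_on_def)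
  ultimately have "card ?K = 4" by simp
  then obtain xs where xs: "set xs = ?K" "length xs = 4" "distinct xs"
    using finite_distinct_list[of ?K] fin by (auto simp: distinct_card[symmetric])
  then obtain a b c d where xs_eq: "xs = [a, b, c, d]"
    by (auto simp: eval_nat_numeral length_Suc_conv)
  have K: "?K = {a, b, c, d}" and dist: "distinct [a, b, c, d]"
    using xs xs_eq by auto
  define outer where "outer = card {w \<in> V - ?K. r a w}"
  have a: "a \<in> V" "D a = k" using K by auto
  have "D u = card {w \<in> ?K. w \<noteq> u \<and> r u w} + outer" if "u \<in> ?K" for u
  proof -
    have "{w \<in> V. w \<noteq> u \<and> r u w} = {w \<in> ?K. w \<noteq> u \<and> r u w} \<union> {w \<in> V - ?K. r u w}"
      using that by auto
    moreover have "{w \<in> V - ?K. r u w} = {w \<in> V - ?K. r a w}"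
      using color_between_classes[OF four, of u a] that a by auto
    ultimately show ?thesis
      using D[of u] that fin unfolding outer_def
      by (subst card_Un_disjoint[symmetric]) auto
  qed
  then have inner: "card {w \<in> {a, b, c, d}. w \<noteq> u \<and> r u w} = k - outer" if "u \<in> ?K" for u
    using that unfolding K[symmetric] by fastforce
  have alt: "r w x \<noteq> r y z" if "distinct [w, x, y, z]" "{w, x, y, z} \<subseteq> ?K" for w x y z
    using that by (intro alternating) (auto simp: equal_or_distinct_on_def)
  have m: "r a b \<noteq> r c d" "r a c \<noteq> r b d" "r a d \<noteq> r b c"
    by (rule alt; use K dist in auto)+
  have count: "card {w \<in> {a, b, c, d}. P w} =
      of_bool (P a) + of_bool (P b) + of_bool (P c) + of_bool (P d)"
    for P
  proof -
    have "card {w \<in> {a, b, c, d}. P w} = (\<Sum>w \<in> {a, b, c, d}. of_bool (P w))"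
      by (simp add: sum.inter_filter[symmetric] Int_def)
    then show ?thesis using dist by simp
  qed
  have "a \<in> ?K" "b \<in> ?K" "c \<in> ?K" "d \<in> ?K" using K by auto
  note deg = this[THEN inner, unfolded count]
  show False
    using deg dist m sym[of b a] sym[of c a] sym[of d a] sym[of c b] sym[of d b] sym[of d c]
    by (cases "r a b"; cases "r a c"; cases "r a d") auto
qed

lemma card_le_12: "card V \<le> 12"
proof -
  have bound: "card V \<le> s * card (D ` V)" if "\<And>k. card {v \<in> V. D v = k} \<le> s" for s
  proof -
    have "card V = (\<Sum>k \<in> D ` V. card {v \<in> V. D v = k})"
      using sum.image_gen[OF fin, of "\<lambda>_. 1 :: nat" D] by simp
    also have "\<dots> \<le> of_nat (card (D ` V)) * s"
      using that by (intro sum_bounded_above) auto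
    finally show ?thesis by (simp add: mult.commute)
  qed
  obtain T where "T \<subseteq> V" "inj_on D T" "D ` V = D ` T"
    by (metis subset_image_inj subset_refl)
  then have "card (D ` V) \<le> 4"
    using card_equal_or_distinct_le_4[of T] by (simp add: card_image equal_or_distinct_on_def)
  moreover have "card {v \<in> V. D v = k} \<le> 4" for k
    by (rule card_equal_or_distinct_le_4) (auto simp: equal_or_distinct_on_def)
  ultimately show ?thesis
    using bound[of 4] bound[of 3] card_degree_class_le_3 by (cases "card (D ` V) = 4") auto
qed

end

section \<open>The three Ramsey numbers\<close>

lemma Rs_P4_le: "Rs P4 \<le> 13"
proof -
  have "has_singular_copy (color_graph m c 1) P4 \<or> has_singular_copy (color_graph m c 2) P4"
    if m: "13 \<le> m" and c: "c \<in> edges (complete_graph m) \<rightarrow> {1, 2}" for m c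
  proof -
    let ?r = "\<lambda>u v. c {u, v} = 1" and ?D = "degree (color_graph m c 1)"
    have sym: "?r x y \<longleftrightarrow> ?r y x" for x y by (simp add: insert_commute)
    have "\<not> alternating_matchings {..<m} ?r ?D"
      using alternating_matchings.card_le_12[of "{..<m}" ?r ?D] m by auto
    then obtain a b c' d where abcd: "distinct [a, b, c', d]" "{a, b, c', d} \<subseteq> {..<m}"
      "equal_or_distinct_on ?D {a, b, c', d}" "?r a b \<longleftrightarrow> ?r c' d"
      unfolding alternating_matchings_def by (auto simp: insert_commute degree_color_graph)
    obtain w x y z where path: "distinct [w, x, y, z]" "{w, x, y, z} = {a, b, c', d}"
      "?r w x \<longleftrightarrow> ?r x y" "?r x y \<longleftrightarrow> ?r y z"
      by (rule mono_matching_imp_mono_path[of ?r, OF sym abcd(1,4)])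
    have lt: "w < m" "x < m" "y < m" "z < m" using path(2) abcd(2) by auto
    define i where "i = c {w, x}"
    have i: "i \<in> {1, 2}" "c {x, y} = i" "c {y, z} = i"
      using coloring_cases[OF c, of w x] coloring_cases[OF c, of x y] coloring_cases[OF c, of y z]
        path lt unfolding i_def by auto
    have "equal_or_distinct_on (degree (color_graph m c i)) {w, x, y, z}"
      using equal_or_distinct_on_degree_color_graph[OF c abcd(2) i(1)] abcd(3) path(2) by simp
    then have "has_singular_copy (color_graph m c i) P4"
      using path(1) lt i by (intro has_singular_copy_P4I[of w x y z])
        (auto simp: edge_color_graph_iff i_def)
    then show ?thesis using i(1) by auto
  qed
  then have "singular_ramsey_bound P4 P4 13"
    by (simp add: singular_ramsey_bound_def)
  then have "Rs P4 \<le> enat 13"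
    unfolding Rs_def Rs2_def by (intro Inf_lower) blast
  then show ?thesis by (simp add: numeral_eq_enat)
qed

theorem theorem26:
  "Rs two_K2 = 13 \<and> Rs2 two_K2 P4 = 13 \<and> Rs P4 = 13"
proof -
  have "Rs two_K2 \<le> Rs2 two_K2 P4" "Rs2 two_K2 P4 \<le> Rs P4"
    unfolding Rs_def by (rule Rs2_mono; simp add: has_singular_copy_P4_imp_two_K2)+
  then show ?thesis
    using Rs_two_K2_ge Rs_P4_le by (meson order.antisym order.trans)
qed

end
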